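(* Let $f:[0,1]\to\mathbb{R}$ be continuous and of bounded variation. Then $$\mathrm{HFD}(f,N,2)\longrightarrow 1=\dim_B(\mathrm{graph}(f))\qquad\text{as } N\to\infty,$$ where the limit is taken over those $N\in\mathbb{N}$ for which the pair $(N,2)$ is admissible.
   Context: $\mathrm{graph}(f)=\{(t,f(t)) : t\in[0,1]\}\subset\mathbb{R}^2$. For a nonempty bounded $F\subset\mathbb{R}^n$ and $\delta>0$, let $N_\delta(F)$ be the smallest number of boxes of side length $\delta$ needed to cover $F$; the box-counting dimension is $\dim_B(F)=\lim_{\delta\to0+}\frac{\log N_\delta(F)}{\log(1/\delta)}$, provided the limit exists. Higuchi fractal dimension (HFD). A pair $(N,k_{\max})$ of positive integers is called admissible if $N\ge 2$ and $k_{\max}\le\lfloor N/2\rfloor$. Given a bounded function $f:[0,1]\to\mathbb{R}$ and an admissible pair $(N,k_{\max})$, put $X_N(j)=f\left(\frac{j-1}{N-1}\right)$ for $j=1,\dots,N$. For $1\le m\le k\le k_{\max}$ define $$C_{N,k,m}=\frac{N-1}{\lfloor\frac{N-m}{k}\rfloor k},\qquad V_{N,k,m}=\sum_{i=1}^{\lfloor\frac{N-m}{k}\rfloor}|X_N(m+ik)-X_N(m+(i-1)k)|,$$ $$L_m(k)=\frac1k C_{N,k,m}V_{N,k,m},\qquad L(k)=\frac1k\sum_{m=1}^k L_m(k).$$ Let $\mathcal{I}=\{k\in\{1,\dots,k_{\max}\} : L(k)\ne0\}$ and $\mathcal{Z}=\{(\log\frac1k,\log L(k)) : k\in\mathcal{I}\}$.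 If $|\mathcal{I}|\le1$, set $\mathrm{HFD}(f,N,k_{\max})=1$. Otherwise $\mathrm{HFD}(f,N,k_{\max})$ is the slope of the least-squares best fitting affine function through $\mathcal{Z}$, where the slope for data $(x_1,y_1),\dots,(x_n,y_n)$ is $\frac{\sum_i(x_i-\overline{x})(y_i-\overline{y})}{\sum_i(x_i-\overline{x})^2}$ with $\overline{x},\overline{y}$ the arithmetic means. *)

theory Defs
  imports "HOL-Analysis.Analysis"
begin

definition bounded_variation_on_interval :: "(real \<Rightarrow> real) \<Rightarrow> real \<Rightarrow> real \<Rightarrow> bool" where
  "bounded_variation_on_interval f a b \<longleftrightarrow>
     (\<exists>M. \<forall>(n::nat) (t :: nat \<Rightarrow> real).
        t 0 = a \<and> t n = b \<and> (\<forall>i<n. t i < t (Suc i)) \<longrightarrow>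
        (\<Sum>i<n. \<bar>f (t (Suc i)) - f (t i)\<bar>) \<le> M)"

definition fun_graph :: "(real \<Rightarrow> real) \<Rightarrow> (real \<times> real) set" where
  "fun_graph f = {(t, f t) | t. t \<in> {0..1}}"

text \<open>
  Boxes are closed and axis-parallel, with arbitrary position; \<open>C\<close> is the set of their
  lower corners. The minimum exists for bounded \<open>F\<close> and positive \<open>\<delta>\<close>, the only case used.
\<close>

definition box_count :: "real \<Rightarrow> 'a::euclidean_space set \<Rightarrow> nat" where
  "box_count \<delta> F =
     (LEAST n. \<exists>C. finite C \<and> card C = n \<and> F \<subseteq> (\<Union>c\<in>C. cbox c (c + \<delta> *\<^sub>R One)))"

text \<open>As the limit need not exist, the dimension is a relation: \<open>dim\<^sub>B F\<close> exists and equals \<open>d\<close>.\<close>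

definition has_box_dim :: "'a::euclidean_space set \<Rightarrow> real \<Rightarrow> bool" where
  "has_box_dim F d \<longleftrightarrow> F \<noteq> {} \<and> bounded F \<and>
     ((\<lambda>\<delta>. ln (real (box_count \<delta> F)) / ln (1 / \<delta>)) \<longlongrightarrow> d) (at_right 0)"

definition admissible :: "nat \<Rightarrow> nat \<Rightarrow> bool" where
  "admissible N kmax \<longleftrightarrow> N \<ge> 2 \<and> kmax \<ge> 1 \<and> kmax \<le> N div 2"

text \<open>
  The definitions below are total. They carry their intended meaning for admissible
  \<open>(N, kmax)\<close> and \<open>1 \<le> m \<le> k \<le> kmax\<close>; then the subtractions on \<open>nat\<close> do not truncate,
  the denominators are nonzero, and \<open>f\<close> is sampled only at points of \<open>[0,1]\<close>.
\<close>

definition hig_X :: "(real \<Rightarrow> real) \<Rightarrow> nat \<Rightarrow> nat \<Rightarrow> real" where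
  "hig_X f N j = f ((real j - 1) / (real N - 1))"

definition hig_C :: "nat \<Rightarrow> nat \<Rightarrow> nat \<Rightarrow> real" where
  "hig_C N k m = (real N - 1) / real (((N - m) div k) * k)"

definition hig_V :: "(real \<Rightarrow> real) \<Rightarrow> nat \<Rightarrow> nat \<Rightarrow> nat \<Rightarrow> real" where
  "hig_V f N k m =
     (\<Sum>i = 1..(N - m) div k. \<bar>hig_X f N (m + i * k) - hig_X f N (m + (i - 1) * k)\<bar>)"

definition hig_Lm :: "(real \<Rightarrow> real) \<Rightarrow> nat \<Rightarrow> nat \<Rightarrow> nat \<Rightarrow> real" where
  "hig_Lm f N m k = 1 / real k * hig_C N k m * hig_V f N k m"

definition hig_L :: "(real \<Rightarrow> real) \<Rightarrow> nat \<Rightarrow> nat \<Rightarrow> real" where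
  "hig_L f N k = 1 / real k * (\<Sum>m = 1..k. hig_Lm f N m k)"

definition hig_I :: "(real \<Rightarrow> real) \<Rightarrow> nat \<Rightarrow> nat \<Rightarrow> nat set" where
  "hig_I f N kmax = {k \<in> {1..kmax}. hig_L f N k \<noteq> 0}"

definition hig_Z :: "(real \<Rightarrow> real) \<Rightarrow> nat \<Rightarrow> nat \<Rightarrow> (real \<times> real) set" where
  "hig_Z f N kmax = (\<lambda>k. (ln (1 / real k), ln (hig_L f N k))) ` hig_I f N kmax"

definition mean_on :: "('a \<Rightarrow> real) \<Rightarrow> 'a set \<Rightarrow> real" where
  "mean_on g A = (\<Sum>a\<in>A. g a) / real (card A)"

definition lsq_slope :: "(real \<times> real) set \<Rightarrow> real" where
  "lsq_slope Z =
     (\<Sum>(x, y)\<in>Z. (x - mean_on fst Z) * (y - mean_on snd Z)) /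
     (\<Sum>(x, y)\<in>Z. (x - mean_on fst Z)\<^sup>2)"

definition HFD :: "(real \<Rightarrow> real) \<Rightarrow> nat \<Rightarrow> nat \<Rightarrow> real" where
  "HFD f N kmax =
     (if card (hig_I f N kmax) \<le> 1 then 1 else lsq_slope (hig_Z f N kmax))"

end

(*
  Let W x be the total variation of f on [0,x]; then |f y - f x| <= W y - W x for x <= y.

  Since f is continuous, the variation of f along sample points that become dense in [0,1]
  tends to W 1. Hence L(k) tends to W 1 / k for every fixed k. If W 1 > 0, the slope
  (ln L(1) - ln L(2)) / ln 2 tends to 1; if W 1 = 0, all L(k) vanish and HFD is 1 by convention.

  For the box dimension, cut the range [0, 1 + W 1] of x + W x into pieces of length delta:
  over each piece both coordinates of the graph vary by at most delta, so O(1/delta) boxes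
  suffice, while projecting to the first axis shows that 1/delta boxes are needed.
*)
theory Submission
  imports Defs "HOL-Real_Asymp.Real_Asymp"
begin

section \<open>Total variation\<close>

text \<open>The partitions are those of \<open>bounded_variation_on_interval\<close>, which
  therefore says that the set for the whole interval is bounded above. Strictness leaves only n = 0
  when \<open>a = b\<close>, so the set is then {0}.\<close>

definition variation_sums :: "(real \<Rightarrow> real) \<Rightarrow> real \<Rightarrow> real \<Rightarrow> real set" where
  "variation_sums f a b =
     {\<Sum>i<n. \<bar>f (t (Suc i)) - f (t i)\<bar> | n t. t 0 = a \<and> t n = b \<and> (\<forall>i<n. t i < t (Suc i))}"

definition total_variation :: "(real \<Rightarrow> real) \<Rightarrow> real \<Rightarrow> real \<Rightarrow> real" where
  "total_variation f a b = Sup (variation_sums f a b)"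

lemma zero_in_variation_sums: "0 \<in> variation_sums f a a"
  unfolding variation_sums_def by (auto intro!: exI[of _ 0] exI[of _ "\<lambda>_. a"])

text \<open>Appending y as a last partition point adds one term. This single step yields both the
  boundedness of the sums on subintervals and the increment bound for
  \<open>total_variation\<close>.\<close>

lemma variation_sums_extend:
  assumes "s \<in> variation_sums f a x" "x < y"
  shows "s + \<bar>f y - f x\<bar> \<in> variation_sums f a y"
proof -
  obtain n t where t: "s = (\<Sum>i<n. \<bar>f (t (Suc i)) - f (t i)\<bar>)"
      "t 0 = a" "t n = x" "\<forall>i<n. t i < t (Suc i)"
    using assms(1) unfolding variation_sums_def by auto
  define u where "u = t(Suc n := y)"
  have "s + \<bar>f y - f x\<bar> = (\<Sum>i<Suc n. \<bar>f (u (Suc i)) - f (u i)\<bar>)"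
    using t by (simp add: u_def)
  moreover have "u 0 = a" "u (Suc n) = y" "\<forall>i<Suc n. u i < u (Suc i)"
    using t assms(2) by (auto simp: u_def less_Suc_eq)
  ultimately show ?thesis
    unfolding variation_sums_def by blast
qed

lemma variation_sums_nonempty:
  assumes "a \<le> x"
  shows "variation_sums f a x \<noteq> {}"
  using zero_in_variation_sums[of f a] variation_sums_extend[of 0 f a a x] assms
  by (cases "a = x") auto

lemma bdd_above_variation_sums:
  assumes "bounded_variation_on_interval f a b" "x \<le> b"
  shows "bdd_above (variation_sums f a x)"
proof -
  obtain M where M: "\<And>s. s \<in> variation_sums f a b \<Longrightarrow> s \<le> M"
    using assms(1) unfolding bounded_variation_on_interval_def variation_sums_def by blast
  have "s \<le> M" if "s \<in> variation_sums f a x" for s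
  proof (cases "x = b")
    case False
    then have "s + \<bar>f b - f x\<bar> \<le> M"
      using M variation_sums_extend that assms(2) by simp
    then show ?thesis by linarith
  qed (use M that in auto)
  then show ?thesis by (rule bdd_aboveI)
qed

lemma total_variation_self_nonneg:
  assumes "bounded_variation_on_interval f a b" "a \<le> b"
  shows "0 \<le> total_variation f a a"
  unfolding total_variation_def
  by (intro cSup_upper zero_in_variation_sums bdd_above_variation_sums[OF assms])

text \<open>Every sum up to x, extended by y, is a sum up to y; take the supremum over the former.
  In particular the variation function is nondecreasing.\<close>

lemma abs_diff_le_total_variation:
  assumes "bounded_variation_on_interval f a b" "a \<le> x" "x \<le> y" "y \<le> b"
  shows "\<bar>f y - f x\<bar> \<le> total_variation f a y - total_variation f a x"
proof (cases "x = y")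
  case False
  have "s \<le> total_variation f a y - \<bar>f y - f x\<bar>" if "s \<in> variation_sums f a x" for s
  proof -
    have "s + \<bar>f y - f x\<bar> \<le> total_variation f a y"
      unfolding total_variation_def
      using variation_sums_extend[OF that] False assms bdd_above_variation_sums
      by (intro cSup_upper) auto
    then show ?thesis by simp
  qed
  then have "total_variation f a x \<le> total_variation f a y - \<bar>f y - f x\<bar>"
    unfolding total_variation_def[of f a x]
    by (intro cSup_least variation_sums_nonempty assms)
  then show ?thesis by simp
qed simp

lemma total_variation_nonneg:
  assumes "bounded_variation_on_interval f a b" "a \<le> b"
  shows "0 \<le> total_variation f a b"
  using total_variation_self_nonneg[OF assms] abs_diff_le_total_variation[OF assms(1), of a b]
    assms(2) by simp

text \<open>The points may repeat and may miss both endpoints, so the sum need not be one of the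
  \<open>variation_sums\<close>. Bounding each term by an increment of the variation function makes
  the sum telescope.\<close>

lemma sum_abs_diff_le_total_variation:
  assumes bv: "bounded_variation_on_interval f a b"
    and p: "\<And>i. i \<le> n \<Longrightarrow> p i \<in> {a..b}" "\<And>i. i < n \<Longrightarrow> p i \<le> p (Suc i)"
  shows "(\<Sum>i<n. \<bar>f (p (Suc i)) - f (p i)\<bar>) \<le> total_variation f a b"
proof -
  let ?W = "total_variation f a"
  have ab: "a \<le> p 0" "p 0 \<le> b" "a \<le> p n" "p n \<le> b" using p(1) by auto
  have "(\<Sum>i<n. \<bar>f (p (Suc i)) - f (p i)\<bar>) \<le> (\<Sum>i<n. ?W (p (Suc i)) - ?W (p i))"
    using p by (intro sum_mono abs_diff_le_total_variation[OF bv]) (auto simp: Suc_le_eq)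
  also have "\<dots> = ?W (p n) - ?W (p 0)"
    by (rule sum_lessThan_telescope)
  also have "\<dots> \<le> ?W b - ?W a"
    using abs_diff_le_total_variation[OF bv, of "p n" b]
      abs_diff_le_total_variation[OF bv, of a "p 0"] ab by linarith
  also have "\<dots> \<le> ?W b"
    using total_variation_self_nonneg[OF bv] ab by simp
  finally show ?thesis .
qed

text \<open>By the triangle inequality, skipping indices cannot increase the variation. Repeated
  indices contribute 0, so weak monotonicity of q is enough.\<close>

lemma sum_abs_diff_subsequence_le:
  fixes g :: "nat \<Rightarrow> real"
  assumes "\<And>i. i < n \<Longrightarrow> q i \<le> q (Suc i)" "q n \<le> K"
  shows "(\<Sum>i<n. \<bar>g (q (Suc i)) - g (q i)\<bar>) \<le> (\<Sum>i<K. \<bar>g (Suc i) - g i\<bar>)"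
proof -
  have "(\<Sum>i<n. \<bar>g (q (Suc i)) - g (q i)\<bar>) \<le> (\<Sum>i<q n. \<bar>g (Suc i) - g i\<bar>)"
    using assms(1)
  proof (induction n)
    case (Suc n)
    have q: "q n \<le> q (Suc n)" using Suc.prems by simp
    have "\<bar>g (q (Suc n)) - g (q n)\<bar> \<le> (\<Sum>i = q n..<q (Suc n). \<bar>g (Suc i) - g i\<bar>)"
      using sum_abs[of "\<lambda>i. g (Suc i) - g i" "{q n..<q (Suc n)}"] sum_Suc_diff'[OF q, of g] by simp
    moreover have "(\<Sum>i<q (Suc n). \<bar>g (Suc i) - g i\<bar>) =
        (\<Sum>i<q n. \<bar>g (Suc i) - g i\<bar>) + (\<Sum>i = q n..<q (Suc n). \<bar>g (Suc i) - g i\<bar>)"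
      using sum.atLeastLessThan_concat[of 0 "q n" "q (Suc n)" "\<lambda>i. \<bar>g (Suc i) - g i\<bar>"] q
      by (simp add: atLeast0LessThan)
    ultimately show ?case using Suc by simp
  qed (simp add: sum_nonneg)
  also have "\<dots> \<le> (\<Sum>i<K. \<bar>g (Suc i) - g i\<bar>)"
    using assms(2) by (intro sum_mono2) auto
  finally show ?thesis .
qed

text \<open>\<open>J N t\<close> is the index of a sample point of the \<open>N\<close>-th sample that approximates \<open>t\<close>.\<close>

lemma tendsto_total_variation_samples:
  fixes p :: "nat \<Rightarrow> nat \<Rightarrow> real" and J :: "nat \<Rightarrow> real \<Rightarrow> nat"
  assumes cont: "continuous_on {a..b} f" and bv: "bounded_variation_on_interval f a b"
    and ab: "a \<le> b"
    and range: "\<forall>\<^sub>F N in sequentially. \<forall>i\<le>K N. p N i \<in> {a..b}"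
    and mono: "\<forall>\<^sub>F N in sequentially. \<forall>i<K N. p N i \<le> p N (Suc i)"
    and J: "\<And>N. mono (J N)" "\<And>N t. t \<in> {a..b} \<Longrightarrow> J N t \<le> K N"
    and lim: "\<And>t. t \<in> {a..b} \<Longrightarrow> (\<lambda>N. p N (J N t)) \<longlonglongrightarrow> t"
  shows "(\<lambda>N. \<Sum>i<K N. \<bar>f (p N (Suc i)) - f (p N i)\<bar>) \<longlonglongrightarrow> total_variation f a b"
proof (rule order_tendstoI)
  \<comment> \<open>Upper half: no sample variation exceeds the total variation.\<close>
  fix u assume u: "total_variation f a b < u"
  show "\<forall>\<^sub>F N in sequentially. (\<Sum>i<K N. \<bar>f (p N (Suc i)) - f (p N i)\<bar>) < u"
    using range mono
  proof eventually_elim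
    case (elim N)
    then show ?case
      using sum_abs_diff_le_total_variation[OF bv, of "K N" "p N"] u by fastforce
  qed
next
  \<comment> \<open>Lower half: fix a partition whose sum exceeds l and replace its points by nearby
    sample points. By continuity the sum moves little, and the full sample only refines the chosen
    points.\<close>
  fix l assume l: "l < total_variation f a b"
  obtain n t where t: "l < (\<Sum>i<n. \<bar>f (t (Suc i)) - f (t i)\<bar>)"
      "t 0 = a" "t n = b" "\<forall>i<n. t i < t (Suc i)"
    using l less_cSupD[OF variation_sums_nonempty[OF ab, of f], of l]
    unfolding total_variation_def variation_sums_def by auto
  have tmono: "t i \<le> t j" if "i \<le> j" "j \<le> n" for i j
    using that
  proof (induction j rule: dec_induct)
    case (step j)
    then have "t j < t (Suc j)" using t(4) by simp
    then show ?case using step by simp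
  qed simp
  have tin: "t i \<in> {a..b}" if "i \<le> n" for i
    using tmono[of 0 i] tmono[of i n] that t by simp
  have flim: "(\<lambda>N. f (p N (J N (t i)))) \<longlonglongrightarrow> f (t i)" if "i \<le> n" for i
  proof (rule continuous_on_tendsto_compose[OF cont lim])
    show "\<forall>\<^sub>F N in sequentially. p N (J N (t i)) \<in> {a..b}"
      using range by eventually_elim (use J(2) tin that in blast)
  qed (use tin that in auto)
  have "(\<lambda>N. \<Sum>i<n. \<bar>f (p N (J N (t (Suc i)))) - f (p N (J N (t i)))\<bar>)
          \<longlonglongrightarrow> (\<Sum>i<n. \<bar>f (t (Suc i)) - f (t i)\<bar>)"
    by (intro tendsto_intros flim) auto
  from order_tendstoD(1)[OF this t(1)]
  show "\<forall>\<^sub>F N in sequentially. l < (\<Sum>i<K N. \<bar>f (p N (Suc i)) - f (p N i)\<bar>)"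
  proof eventually_elim
    case (elim N)
    have "(\<Sum>i<n. \<bar>f (p N (J N (t (Suc i)))) - f (p N (J N (t i)))\<bar>)
            \<le> (\<Sum>i<K N. \<bar>f (p N (Suc i)) - f (p N i)\<bar>)"
      \<comment> \<open>The chosen indices are nondecreasing because both t and \<open>J N\<close>
        are; for small N some may coincide.\<close>
      using sum_abs_diff_subsequence_le[of n "\<lambda>i. J N (t i)" "K N" "\<lambda>i. f (p N i)"]
        J(1)[of N] J(2)[OF tin[of n]] tmono by (auto simp: mono_def)
    then show ?case using elim by simp
  qed
qed

section \<open>Convergence of the Higuchi curve lengths\<close>

text \<open>Rounding down to a multiple of k loses less than k, so the numerator lies between N - m
  - k and N. The quotient is the reciprocal of \<open>hig_C\<close> and also locates the sample
  points.\<close>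

lemma tendsto_sample_density:
  assumes "k \<ge> 1"
  shows "(\<lambda>N. real ((N - m) div k * k) / (real N - 1)) \<longlonglongrightarrow> 1"
proof (rule tendsto_sandwich)
  show "(\<lambda>N. (real N - real m - real k) / (real N - 1)) \<longlonglongrightarrow> 1"
    by real_asymp
  show "(\<lambda>N. real N / (real N - 1)) \<longlonglongrightarrow> 1"
    by real_asymp
  have bounds: "real N - real m - real k \<le> real ((N - m) div k * k)"
      "real ((N - m) div k * k) \<le> real N" for N
  proof -
    have "N \<le> (N - m) div k * k + m + k"
      using div_mult_mod_eq[of "N - m" k] mod_less_divisor[of k "N - m"] assms by linarith
    then have "real N \<le> real ((N - m) div k * k + m + k)" by (rule of_nat_mono)
    then show "real N - real m - real k \<le> real ((N - m) div k * k)" by simp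
    have "(N - m) div k * k \<le> N"
      using div_times_less_eq_dividend[of "N - m" k] by linarith
    then show "real ((N - m) div k * k) \<le> real N" by (rule of_nat_mono)
  qed
  show "\<forall>\<^sub>F N in sequentially. (real N - real m - real k) / (real N - 1)
          \<le> real ((N - m) div k * k) / (real N - 1)"
    using eventually_ge_at_top[of 2] by eventually_elim (intro divide_right_mono bounds, simp)
  show "\<forall>\<^sub>F N in sequentially. real ((N - m) div k * k) / (real N - 1) \<le> real N / (real N - 1)"
    using eventually_ge_at_top[of 2] by eventually_elim (intro divide_right_mono bounds, simp)
qed

lemma hig_C_tendsto:
  assumes "k \<ge> 1"
  shows "(\<lambda>N. hig_C N k m) \<longlonglongrightarrow> 1"
  using tendsto_inverse[OF tendsto_sample_density[OF assms, of m]]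
  by (simp add: hig_C_def inverse_eq_divide)

lemma hig_V_eq:
  "hig_V f N k m = (\<Sum>i<(N - m) div k.
     \<bar>f ((real (m + Suc i * k) - 1) / (real N - 1)) - f ((real (m + i * k) - 1) / (real N - 1))\<bar>)"
  unfolding hig_V_def hig_X_def
  by (rule sum.reindex_bij_witness[of _ Suc "\<lambda>i. i - 1"]) auto

lemma hig_V_nonneg: "0 \<le> hig_V f N k m"
  unfolding hig_V_def by (simp add: sum_nonneg)

lemma sample_point_mem:
  assumes "1 \<le> m" "m \<le> N" "2 \<le> N" "i \<le> (N - m) div k"
  shows "(real (m + i * k) - 1) / (real N - 1) \<in> {0..1}"
proof -
  have "i * k \<le> (N - m) div k * k" using assms(4) by simp
  also have "\<dots> \<le> N - m" by simp
  finally have "m + i * k \<le> N" using assms(2) by simp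
  then have "real (m + i * k) \<le> real N" by (rule of_nat_mono)
  moreover have "1 \<le> real (m + i * k)" using assms(1) by linarith
  ultimately show ?thesis using assms(3) by (simp add: divide_simps)
qed

lemma sample_point_le_Suc:
  assumes "2 \<le> N"
  shows "(real (m + i * k) - 1) / (real N - 1) \<le> (real (m + Suc i * k) - 1) / (real N - 1)"
  using assms by (intro divide_right_mono) auto

text \<open>A bound for each individual N: it makes the curve lengths vanish exactly when the total
  variation is 0, where a limit statement would not suffice.\<close>

lemma hig_V_le:
  assumes "bounded_variation_on_interval f 0 1" "1 \<le> m" "m \<le> N" "2 \<le> N"
  shows "hig_V f N k m \<le> total_variation f 0 1"
  unfolding hig_V_eq
  using sum_abs_diff_le_total_variation[OF assms(1), of "(N - m) div k"
      "\<lambda>i. (real (m + i * k) - 1) / (real N - 1)"]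
    sample_point_mem sample_point_le_Suc assms by simp

lemma hig_V_tendsto:
  assumes "continuous_on {0..1} f" "bounded_variation_on_interval f 0 1" "1 \<le> m" "1 \<le> k"
  shows "(\<lambda>N. hig_V f N k m) \<longlonglongrightarrow> total_variation f 0 1"
proof -
  define K where "K = (\<lambda>N. (N - m) div k)"
  define p where "p = (\<lambda>N i. (real (m + i * k) - 1) / (real N - 1))"
  \<comment> \<open>The fraction t of the \<open>K N\<close> steps leads to a point near t, because
    the sample nearly fills [0,1]. The floor keeps \<open>J N\<close> monotone and at most
    \<open>K N\<close>.\<close>
  define J where "J = (\<lambda>N (t::real). nat \<lfloor>t * real (K N)\<rfloor>)"
  have "(\<lambda>N. \<Sum>i<K N. \<bar>f (p N (Suc i)) - f (p N i)\<bar>) \<longlonglongrightarrow> total_variation f 0 1"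
  proof (rule tendsto_total_variation_samples[where J = J, OF assms(1,2)])
    show "\<forall>\<^sub>F N in sequentially. \<forall>i\<le>K N. p N i \<in> {0..1}"
      using eventually_ge_at_top[of "max 2 m"]
      by eventually_elim (use sample_point_mem assms in \<open>auto simp: K_def p_def\<close>)
    show "\<forall>\<^sub>F N in sequentially. \<forall>i<K N. p N i \<le> p N (Suc i)"
      using eventually_ge_at_top[of 2]
      unfolding p_def by eventually_elim (intro allI impI sample_point_le_Suc)
    show "mono (J N)" for N
      unfolding J_def by (intro monoI nat_mono floor_mono mult_right_mono) auto
    show "J N t \<le> K N" if "t \<in> {0..1}" for N t
    proof -
      have "t * real (K N) \<le> real (K N)" using that by (simp add: mult_left_le_one_le)
      then show ?thesis unfolding J_def by linarith
    qed
    show "(\<lambda>N. p N (J N t)) \<longlonglongrightarrow> t" if t: "t \<in> {0..1}" for t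
    proof (rule tendsto_sandwich)
      have J_bounds: "t * real (K N) - 1 \<le> real (J N t)" "real (J N t) \<le> t * real (K N)" for N
      proof -
        have "0 \<le> t * real (K N)" using t by simp
        then show "t * real (K N) - 1 \<le> real (J N t)" "real (J N t) \<le> t * real (K N)"
          unfolding J_def by linarith+
      qed
      \<comment> \<open>Rounding in J costs at most one step of k grid points, so c = m - 1 - k
        serves the lower bound and c = m - 1 the upper one.\<close>
      have lim: "(\<lambda>N. c / (real N - 1) + t * (real (K N * k) / (real N - 1))) \<longlonglongrightarrow> 0 + t * 1" for c
        unfolding K_def by (intro tendsto_intros tendsto_sample_density assms) real_asymp
      show "(\<lambda>N. (real m - 1 - real k) / (real N - 1) + t * (real (K N * k) / (real N - 1))) \<longlonglongrightarrow> t"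
        "(\<lambda>N. (real m - 1) / (real N - 1) + t * (real (K N * k) / (real N - 1))) \<longlonglongrightarrow> t"
        using lim by simp_all
      show "\<forall>\<^sub>F N in sequentially. (real m - 1 - real k) / (real N - 1)
              + t * (real (K N * k) / (real N - 1)) \<le> p N (J N t)"
        using eventually_ge_at_top[of 2]
      proof eventually_elim
        case (elim N)
        have "(t * real (K N) - 1) * real k \<le> real (J N t) * real k"
          by (intro mult_right_mono J_bounds) simp
        then have "(real m - 1 - real k + t * real (K N * k)) / (real N - 1) \<le> p N (J N t)"
          unfolding p_def using elim by (intro divide_right_mono) (auto simp: algebra_simps)
        then show ?case by (simp add: add_divide_distrib)
      qed
      show "\<forall>\<^sub>F N in sequentially. p N (J N t) \<le> (real m - 1) / (real N - 1)
              + t * (real (K N * k) / (real N - 1))"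
        using eventually_ge_at_top[of 2]
      proof eventually_elim
        case (elim N)
        have "real (J N t) * real k \<le> t * real (K N) * real k"
          by (intro mult_right_mono J_bounds) simp
        then have "p N (J N t) \<le> (real m - 1 + t * real (K N * k)) / (real N - 1)"
          unfolding p_def using elim by (intro divide_right_mono) (auto simp: algebra_simps)
        then show ?case by (simp add: add_divide_distrib)
      qed
    qed
  qed simp
  then show ?thesis by (simp only: hig_V_eq K_def p_def)
qed

text \<open>The limits of \<open>hig_C\<close> and \<open>hig_V\<close> do not depend on m, so
  \<open>hig_L\<close> averages k quantities that all tend to the total variation divided by
  k.\<close>

lemma hig_L_tendsto:
  assumes "continuous_on {0..1} f" "bounded_variation_on_interval f 0 1" "1 \<le> k"
  shows "(\<lambda>N. hig_L f N k) \<longlonglongrightarrow> total_variation f 0 1 / real k"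
proof -
  have "(\<lambda>N. hig_L f N k) \<longlonglongrightarrow>
      1 / real k * (\<Sum>m = 1..k. 1 / real k * 1 * total_variation f 0 1)"
    unfolding hig_L_def hig_Lm_def
    by (intro tendsto_intros hig_C_tendsto hig_V_tendsto assms) auto
  then show ?thesis using assms(3) by simp
qed

section \<open>The least-squares slope\<close>

text \<open>Two points deviate from their mean by opposite amounts, so the quotient collapses to the
  slope of the secant. Distinct abscissas also ensure that the set has two elements.\<close>

lemma lsq_slope_two_points:
  assumes "x1 \<noteq> x2"
  shows "lsq_slope {(x1, y1), (x2, y2)} = (y1 - y2) / (x1 - x2)"
proof -
  have c: "card {(x1, y1), (x2, y2)} = 2" using assms by simp
  have mx: "mean_on fst {(x1, y1), (x2, y2)} = (x1 + x2) / 2"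
    and my: "mean_on snd {(x1, y1), (x2, y2)} = (y1 + y2) / 2"
    unfolding mean_on_def c using assms by simp_all
  have d: "x1 - (x1 + x2) / 2 = (x1 - x2) / 2" "x2 - (x1 + x2) / 2 = - ((x1 - x2) / 2)"
    "y1 - (y1 + y2) / 2 = (y1 - y2) / 2" "y2 - (y1 + y2) / 2 = - ((y1 - y2) / 2)"
    by (simp_all add: field_simps)
  have "lsq_slope {(x1, y1), (x2, y2)} =
      ((x1 - x2) / 2 * ((y1 - y2) / 2) + (x1 - x2) / 2 * ((y1 - y2) / 2)) /
      (((x1 - x2) / 2)\<^sup>2 + ((x1 - x2) / 2)\<^sup>2)"
    unfolding lsq_slope_def mx my using assms by (simp add: d)
  also have "\<dots> = (y1 - y2) / (x1 - x2)"
    using assms by (simp add: power2_eq_square)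
  finally show ?thesis .
qed

lemma HFD_two:
  assumes "hig_L f N 1 \<noteq> 0" "hig_L f N 2 \<noteq> 0"
  shows "HFD f N 2 = (ln (hig_L f N 1) - ln (hig_L f N 2)) / ln 2"
proof -
  have "{1..2::nat} = {1, 2}" by auto
  then have I: "hig_I f N 2 = {1, 2}"
    unfolding hig_I_def using assms by auto
  then have "hig_Z f N 2 = {(0, ln (hig_L f N 1)), (- ln 2, ln (hig_L f N 2))}"
    unfolding hig_Z_def by (simp add: ln_div)
  then show ?thesis
    unfolding HFD_def I by (simp add: lsq_slope_two_points)
qed

lemma HFD_two_tendsto:
  assumes "continuous_on {0..1} f" "bounded_variation_on_interval f 0 1"
  shows "(\<lambda>N. HFD f N 2) \<longlonglongrightarrow> 1"
proof -
  define V where "V = total_variation f 0 1"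
  have V0: "0 \<le> V"
    using total_variation_nonneg[OF assms(2)] by (simp add: V_def)
  have L: "(\<lambda>N. hig_L f N 1) \<longlonglongrightarrow> V" "(\<lambda>N. hig_L f N 2) \<longlonglongrightarrow> V / 2"
    using hig_L_tendsto[OF assms, of 1] hig_L_tendsto[OF assms, of 2] by (simp_all add: V_def)
  show ?thesis
  proof (cases "V = 0")
    case True
    \<comment> \<open>The logarithms of the limits are of no use here. Instead each relevant
      \<open>hig_V\<close> is squeezed between 0 and V = 0, so \<open>hig_I\<close> is empty and the
      default value 1 applies.\<close>
    have "\<forall>\<^sub>F N in sequentially. HFD f N 2 = 1"
      using eventually_ge_at_top[of 2]
    proof eventually_elim
      case (elim N)
      have "hig_V f N k m = 0" if "m \<in> {1..2}" for k m
        using hig_V_le[OF assms(2), of m N k] hig_V_nonneg[of f N k m] that elim True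
        by (simp add: V_def)
      then have "hig_I f N 2 = {}"
        by (auto simp: hig_I_def hig_L_def hig_Lm_def)
      then show ?case by (simp add: HFD_def)
    qed
    then show ?thesis by (rule tendsto_eventually)
  next
    case False
    then have pos: "V > 0" "V / 2 > 0" using V0 by simp_all
    have "(\<lambda>N. (ln (hig_L f N 1) - ln (hig_L f N 2)) / ln 2) \<longlonglongrightarrow> (ln V - ln (V / 2)) / ln 2"
      using pos by (intro tendsto_intros L) auto
    moreover have "(ln V - ln (V / 2)) / ln 2 = 1"
      using pos by (simp add: ln_div)
    \<comment> \<open>Both limits are positive, so eventually both lengths are nonzero and
      \<open>HFD\<close> is given by the two-point formula.\<close>
    moreover have "\<forall>\<^sub>F N in sequentially.
        (ln (hig_L f N 1) - ln (hig_L f N 2)) / ln 2 = HFD f N 2"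
      using order_tendstoD(1)[OF L(1) pos(1)] order_tendstoD(1)[OF L(2) pos(2)]
      by eventually_elim (simp add: HFD_two)
    ultimately show ?thesis
      using Lim_transform_eventually by fastforce
  qed
qed

section \<open>The box dimension of the graph\<close>

text \<open>The map h labels cells in which every coordinate varies by at most \<delta>. One box
  with its corner at the coordinatewise infima then covers a whole cell.\<close>

lemma cover_by_cells:
  fixes F :: "'a::euclidean_space set" and h :: "'a \<Rightarrow> nat"
  assumes h: "\<And>x. x \<in> F \<Longrightarrow> h x < n"
    and cell: "\<And>x y b. x \<in> F \<Longrightarrow> y \<in> F \<Longrightarrow> h x = h y \<Longrightarrow> b \<in> Basis \<Longrightarrow> x \<bullet> b \<le> y \<bullet> b + \<delta>"
  obtains C where "finite C" "card C \<le> n" "F \<subseteq> (\<Union>c\<in>C. cbox c (c + \<delta> *\<^sub>R One))"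
proof
  \<comment> \<open>For a label without points the infimum is an unspecified value; the resulting
    extra box is harmless.\<close>
  define low where "low i = (\<Sum>b\<in>Basis. (INF x\<in>{x \<in> F. h x = i}. x \<bullet> b) *\<^sub>R b)" for i
  have lowb: "low i \<bullet> b = (INF x\<in>{x \<in> F. h x = i}. x \<bullet> b)" if "b \<in> Basis" for i b
    unfolding low_def using that by (simp add: inner_sum_left_Basis)
  show "finite (low ` {..<n})" by simp
  show "card (low ` {..<n}) \<le> n" using card_image_le[of "{..<n}" low] by simp
  show "F \<subseteq> (\<Union>c\<in>low ` {..<n}. cbox c (c + \<delta> *\<^sub>R One))"
  proof
    fix x assume x: "x \<in> F"
    have "low (h x) \<bullet> b \<le> x \<bullet> b \<and> x \<bullet> b \<le> low (h x) \<bullet> b + \<delta>" if b: "b \<in> Basis" for b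
    proof
      \<comment> \<open>This bound serves twice: it makes the infimum a genuine lower bound, and it
        puts x at most \<delta> above it.\<close>
      have "x \<bullet> b - \<delta> \<le> y \<bullet> b" if "y \<in> F" "h y = h x" for y
        using cell[of x y b] x b that by simp
      then have bdd: "bdd_below ((\<lambda>y. y \<bullet> b) ` {y \<in> F. h y = h x})"
        and "x \<bullet> b - \<delta> \<le> (INF y\<in>{y \<in> F. h y = h x}. y \<bullet> b)"
        using x by (auto intro!: bdd_belowI[of _ "x \<bullet> b - \<delta>"] cINF_greatest)
      then show "x \<bullet> b \<le> low (h x) \<bullet> b + \<delta>" using lowb[OF b] by simp
      show "low (h x) \<bullet> b \<le> x \<bullet> b"
        unfolding lowb[OF b] using x by (intro cINF_lower bdd) simp
    qed
    then have "x \<in> cbox (low (h x)) (low (h x) + \<delta> *\<^sub>R One)"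
      by (auto simp: mem_box inner_add_left)
    then show "x \<in> (\<Union>c\<in>low ` {..<n}. cbox c (c + \<delta> *\<^sub>R One))"
      using h[OF x] by auto
  qed
qed

lemma box_count_le:
  assumes "finite C" "F \<subseteq> (\<Union>c\<in>C. cbox c (c + \<delta> *\<^sub>R One))"
  shows "box_count \<delta> F \<le> card C"
  unfolding box_count_def using assms by (intro Least_le) blast

text \<open>Any finite cover shows that the \<open>LEAST\<close> in \<open>box_count\<close> ranges
  over a nonempty set, so the minimum is realised by some cover.\<close>

lemma box_count_attained:
  assumes "finite C" "F \<subseteq> (\<Union>c\<in>C. cbox c (c + \<delta> *\<^sub>R One))"
  obtains D where "finite D" "card D = box_count \<delta> F" "F \<subseteq> (\<Union>c\<in>D. cbox c (c + \<delta> *\<^sub>R One))"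
  using LeastI[of "\<lambda>n. \<exists>C. finite C \<and> card C = n \<and> F \<subseteq> (\<Union>c\<in>C. cbox c (c + \<delta> *\<^sub>R One))" "card C"]
    assms that unfolding box_count_def by blast

lemma graph_cover_card_ge:
  assumes "finite C" "fun_graph f \<subseteq> (\<Union>c\<in>C. cbox c (c + \<delta> *\<^sub>R One))" "0 < \<delta>"
  shows "1 \<le> real (card C) * \<delta>"
proof -
  have one: "(One :: real \<times> real) = (1, 1)"
    by (simp add: sum_Basis_prod_eq)
  have sub: "{0..1} \<subseteq> (\<Union>c\<in>C. {fst c..fst c + \<delta>})"
  proof
    fix t :: real assume "t \<in> {0..1}"
    then have "(t, f t) \<in> (\<Union>c\<in>C. cbox c (c + \<delta> *\<^sub>R One))"
      using assms(2) by (auto simp: fun_graph_def)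
    then obtain a b where "(a, b) \<in> C" "(t, f t) \<in> cbox (a, b) ((a, b) + \<delta> *\<^sub>R One)"
      by auto
    then show "t \<in> (\<Union>c\<in>C. {fst c..fst c + \<delta>})"
      unfolding one by (force simp: cbox_Pair_eq)
  qed
  \<comment> \<open>The projected boxes are intervals of length \<delta> covering [0,1]; compare
    Lebesgue measures.\<close>
  have "1 = measure lborel {0..1::real}" by simp
  also have "\<dots> \<le> measure lborel (\<Union>c\<in>C. {fst c..fst c + \<delta>})"
    using sub assms(1) by (intro measure_mono_fmeasurable fmeasurable.finite_UN fmeasurableI)
       (auto simp: emeasure_lborel_Icc_eq)
  also have "\<dots> \<le> (\<Sum>c\<in>C. measure lborel {fst c..fst c + \<delta>})"
    using assms(1) by (intro measure_UNION_le) auto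
  also have "\<dots> = real (card C) * \<delta>" using assms(3) by simp
  finally show ?thesis .
qed

lemma graph_cover_exists:
  assumes bv: "bounded_variation_on_interval f 0 1" and d: "0 < \<delta>"
  obtains C where "finite C" "real (card C) \<le> (1 + total_variation f 0 1) / \<delta> + 1"
    "fun_graph f \<subseteq> (\<Union>c\<in>C. cbox c (c + \<delta> *\<^sub>R One))"
proof -
  define W where "W = total_variation f 0"
  \<comment> \<open>Both summands are nondecreasing on [0,1], so an increment of g below 1 bounds
    the increments of x and of W by \<delta> separately, and W controls f.\<close>
  define g where "g x = (x + W x) / \<delta>" for x
  define h where "h = (\<lambda>p :: real \<times> real. nat \<lfloor>g (fst p)\<rfloor>)"
  have inc: "\<bar>f y - f x\<bar> \<le> W y - W x" if "0 \<le> x" "x \<le> y" "y \<le> 1" for x y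
    using abs_diff_le_total_variation[OF bv] that by (simp add: W_def)
  have W0: "0 \<le> W 0"
    using total_variation_self_nonneg[OF bv] by (simp add: W_def)
  have g: "0 \<le> g x" "g x \<le> (1 + W 1) / \<delta>" if "x \<in> {0..1}" for x
    using inc[of 0 x] inc[of x 1] W0 that d by (auto simp: g_def intro!: divide_right_mono)
  have close: "\<bar>y - x\<bar> \<le> \<delta> \<and> \<bar>f y - f x\<bar> \<le> \<delta>"
    if "x \<in> {0..1}" "y \<in> {0..1}" "x \<le> y" "\<lfloor>g x\<rfloor> = \<lfloor>g y\<rfloor>" for x y
  proof -
    have "g y - g x \<le> 1" using that(4) by linarith
    then have "(y + W y) - (x + W x) \<le> \<delta>"
      using d by (simp add: g_def diff_divide_distrib[symmetric])
    then show ?thesis using inc[of x y] that by auto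
  qed
  have "h p < nat \<lfloor>(1 + W 1) / \<delta>\<rfloor> + 1" if "p \<in> fun_graph f" for p
  proof -
    have "nat \<lfloor>g (fst p)\<rfloor> \<le> nat \<lfloor>(1 + W 1) / \<delta>\<rfloor>"
      using g(2)[of "fst p"] that by (intro nat_mono floor_mono) (auto simp: fun_graph_def)
    then show ?thesis by (simp add: h_def)
  qed
  moreover have "p \<bullet> b \<le> q \<bullet> b + \<delta>"
    if pq: "p \<in> fun_graph f" "q \<in> fun_graph f" "h p = h q" and b: "b \<in> Basis" for p q b
  proof -
    obtain x y where xy: "p = (x, f x)" "q = (y, f y)" "x \<in> {0..1}" "y \<in> {0..1}"
      using pq by (auto simp: fun_graph_def)
    \<comment> \<open>Nonnegativity is what lets equality of floors be recovered from equality of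
      their images under \<open>nat\<close>.\<close>
    have "0 \<le> \<lfloor>g x\<rfloor>" "0 \<le> \<lfloor>g y\<rfloor>" using g(1)[of x] g(1)[of y] xy by simp_all
    then have "\<lfloor>g x\<rfloor> = \<lfloor>g y\<rfloor>" using pq(3) xy by (simp add: h_def eq_nat_nat_iff)
    then have "\<bar>y - x\<bar> \<le> \<delta> \<and> \<bar>f y - f x\<bar> \<le> \<delta>"
      using close[of x y] close[of y x] xy by linarith
    then show ?thesis using b xy by (auto simp: Basis_prod_def)
  qed
  ultimately obtain C where C: "finite C" "card C \<le> nat \<lfloor>(1 + W 1) / \<delta>\<rfloor> + 1"
      "fun_graph f \<subseteq> (\<Union>c\<in>C. cbox c (c + \<delta> *\<^sub>R One))"
    by (rule cover_by_cells)
  have "0 \<le> (1 + W 1) / \<delta>" using g[of 0] by simp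
  then have "real (card C) \<le> (1 + W 1) / \<delta> + 1" using C(2) by linarith
  then show ?thesis using that C by (simp add: W_def)
qed

lemma has_box_dim_graph:
  assumes cont: "continuous_on {0..1} f" and bv: "bounded_variation_on_interval f 0 1"
  shows "has_box_dim (fun_graph f) 1"
proof -
  define V where "V = total_variation f 0 1"
  have graph_eq: "fun_graph f = (\<lambda>t. (t, f t)) ` {0..1}"
    by (auto simp: fun_graph_def)
  have "compact (fun_graph f)"
    unfolding graph_eq by (intro compact_continuous_image continuous_intros cont) auto
  then have bdd: "bounded (fun_graph f)" by (rule compact_imp_bounded)
  have V0: "0 \<le> V"
    using total_variation_nonneg[OF bv] by (simp add: V_def)
  have bounds: "1 / \<delta> \<le> real (box_count \<delta> (fun_graph f))"
      "real (box_count \<delta> (fun_graph f)) \<le> (2 + V) / \<delta>" if d: "0 < \<delta>" "\<delta> < 1" for \<delta>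
  proof -
    obtain C where C: "finite C" "real (card C) \<le> (1 + V) / \<delta> + 1"
      "fun_graph f \<subseteq> (\<Union>c\<in>C. cbox c (c + \<delta> *\<^sub>R One))"
      using graph_cover_exists[OF bv d(1)] unfolding V_def by blast
    obtain D where D: "finite D" "card D = box_count \<delta> (fun_graph f)"
      "fun_graph f \<subseteq> (\<Union>c\<in>D. cbox c (c + \<delta> *\<^sub>R One))"
      using box_count_attained[OF C(1,3)] by blast
    show "1 / \<delta> \<le> real (box_count \<delta> (fun_graph f))"
      using graph_cover_card_ge[OF D(1,3) d(1)] D(2) d by (simp add: divide_le_eq)
    have "real (box_count \<delta> (fun_graph f)) \<le> (1 + V) / \<delta> + 1"
      using box_count_le[OF C(1,3)] C(2) by linarith
    \<comment> \<open>Since \<delta> < 1, the additive 1 is absorbed into 1 / \<delta>.\<close>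
    also have "\<dots> \<le> (2 + V) / \<delta>" using d by (simp add: field_simps)
    finally show "real (box_count \<delta> (fun_graph f)) \<le> (2 + V) / \<delta>" .
  qed
  have "((\<lambda>\<delta>. ln (real (box_count \<delta> (fun_graph f))) / ln (1 / \<delta>)) \<longlongrightarrow> 1) (at_right 0)"
  proof (rule tendsto_sandwich)
    have small: "\<forall>\<^sub>F \<delta> in at_right (0::real). 0 < \<delta> \<and> \<delta> < 1"
      unfolding eventually_at_right_field by (intro exI[of _ 1]) auto
    show "\<forall>\<^sub>F \<delta> in at_right 0. 1 \<le> ln (real (box_count \<delta> (fun_graph f))) / ln (1 / \<delta>)"
      using small
    proof eventually_elim
      case (elim \<delta>)
      then have "1 < 1 / \<delta>" by simp
      then have "0 < ln (1 / \<delta>)" by (rule ln_gt_zero)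
      moreover have "ln (1 / \<delta>) \<le> ln (real (box_count \<delta> (fun_graph f)))"
        using bounds(1)[of \<delta>] elim by (intro ln_mono) auto
      ultimately show ?case by (simp only: le_divide_eq_1_pos)
    qed
    show "\<forall>\<^sub>F \<delta> in at_right 0. ln (real (box_count \<delta> (fun_graph f))) / ln (1 / \<delta>)
            \<le> ln ((2 + V) / \<delta>) / ln (1 / \<delta>)"
      using small
    proof eventually_elim
      case (elim \<delta>)
      then have "1 < 1 / \<delta>" by simp
      then have "0 < ln (1 / \<delta>)" by (rule ln_gt_zero)
      moreover have "0 < real (box_count \<delta> (fun_graph f))"
        using bounds(1)[of \<delta>] elim \<open>1 < 1 / \<delta>\<close> by linarith
      ultimately show ?case
        using bounds(2)[of \<delta>] elim by (intro divide_right_mono ln_mono) auto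
    qed
    \<comment> \<open>Positivity splits off the constant ln (2 + V), which is negligible against ln
      (1 / \<delta>).\<close>
    have "0 < 2 + V" using V0 by simp
    then show "((\<lambda>\<delta>. ln ((2 + V) / \<delta>) / ln (1 / \<delta>)) \<longlongrightarrow> 1) (at_right 0)"
      by real_asymp
  qed simp
  moreover have "fun_graph f \<noteq> {}" by (simp add: graph_eq)
  ultimately show ?thesis using bdd by (simp add: has_box_dim_def)
qed

theorem theorem3p5:
  fixes f :: "real \<Rightarrow> real"
  assumes "continuous_on {0..1} f"
    and "bounded_variation_on_interval f 0 1"
  shows "((\<lambda>N. HFD f N 2) \<longlongrightarrow> 1) (inf at_top (principal {N. admissible N 2}))
       \<and> has_box_dim (fun_graph f) 1"
  \<comment> \<open>A limit along all N persists along the finer filter. The pair (N, 2) is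
    admissible exactly for N \<ge> 4, so that filter is not trivial.\<close>
  using tendsto_mono[OF inf_le1 HFD_two_tendsto[OF assms]] has_box_dim_graph[OF assms] by blast

end
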